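(* Let $G_1$ and $G_2$ be minimal non-word-representable graphs, and let $H = G_1 \circ G_2$. Then $\mu(H) \le 3$.
   Context: All graphs are simple, undirected and finite. A graph is word-representable if there is a word $w$ over its vertex set such that two distinct vertices are adjacent iff their occurrences alternate in $w$. A graph is minimal non-word-representable if it is not word-representable but all its proper induced subgraphs are word-representable. The union of graphs $G_1,\dots,G_k$ is the graph with vertex set $\bigcup V(G_i)$ and edge set $\bigcup E(G_i)$. The multi-word-representation number $\mu(G)$ is the smallest positive integer $k$ such that $G$ is the union of $k$ word-representable graphs. The lexicographic product $G_1 \circ G_2$ has vertex set $V(G_1)\times V(G_2)$, with $(u,v)$ and $(x,y)$ adjacent iff $\{u,x\}\in E(G_1)$, or $u=x$ and $\{v,y\}\in E(G_2)$. *)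

theory Defs
  imports Main
begin

record 'a graph =
  vertices :: "'a set"
  edges :: "'a set set"

definition simple_graph :: "'a graph \<Rightarrow> bool" where
  "simple_graph G \<longleftrightarrow> finite (vertices G) \<and> (\<forall>e\<in>edges G. e \<subseteq> vertices G \<and> card e = 2)"

definition induced_subgraph :: "'a graph \<Rightarrow> 'a set \<Rightarrow> 'a graph" where
  "induced_subgraph G S = \<lparr>vertices = S, edges = {e \<in> edges G. e \<subseteq> S}\<rparr>"

text \<open>The restriction of the word to the letters x and y contains no other letter, so having no
  two equal neighbours means that it is xyxy... or yxyx..., of even or odd length.\<close>

definition alternate :: "'a list \<Rightarrow> 'a \<Rightarrow> 'a \<Rightarrow> bool" where
  "alternate w x y \<longleftrightarrow> distinct_adj (filter (\<lambda>z. z = x \<or> z = y) w)"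

text \<open>As usual in the theory of word-representable graphs, every vertex has to occur in the word.
  Only requiring \<^term>\<open>set w \<subseteq> vertices G\<close> gives the same class of graphs: vertices that do not occur
  can be put once each in front of the word without changing which pairs alternate.\<close>

definition represents :: "'a list \<Rightarrow> 'a graph \<Rightarrow> bool" where
  "represents w G \<longleftrightarrow> set w = vertices G \<and>
     (\<forall>x\<in>vertices G. \<forall>y\<in>vertices G. x \<noteq> y \<longrightarrow> ({x, y} \<in> edges G \<longleftrightarrow> alternate w x y))"

definition word_representable :: "'a graph \<Rightarrow> bool" where
  "word_representable G \<longleftrightarrow> simple_graph G \<and> (\<exists>w. represents w G)"

definition minimal_non_word_representable :: "'a graph \<Rightarrow> bool" where
  "minimal_non_word_representable G \<longleftrightarrow> simple_graph G \<and> \<not> word_representable G \<and>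
     (\<forall>S. S \<subset> vertices G \<longrightarrow> word_representable (induced_subgraph G S))"

definition graph_union :: "'a graph list \<Rightarrow> 'a graph" where
  "graph_union Gs = \<lparr>vertices = (\<Union>G\<in>set Gs. vertices G), edges = (\<Union>G\<in>set Gs. edges G)\<rparr>"

definition union_of_word_representable :: "nat \<Rightarrow> 'a graph \<Rightarrow> bool" where
  "union_of_word_representable k G \<longleftrightarrow>
     (\<exists>Gs. length Gs = k \<and> (\<forall>K\<in>set Gs. word_representable K) \<and> graph_union Gs = G)"

text \<open>The minimum exists for every simple graph: see \<open>ex_union_of_word_representable\<close> below.\<close>

definition multi_word_representation_number :: "'a graph \<Rightarrow> nat" where
  "multi_word_representation_number G = (LEAST k. 0 < k \<and> union_of_word_representable k G)"

definition lex_product :: "'a graph \<Rightarrow> 'b graph \<Rightarrow> ('a \<times> 'b) graph" where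
  "lex_product G1 G2 = \<lparr>
     vertices = vertices G1 \<times> vertices G2,
     edges = {{(u, v), (x, y)} | u v x y.
       u \<in> vertices G1 \<and> v \<in> vertices G2 \<and> x \<in> vertices G1 \<and> y \<in> vertices G2 \<and>
       ({u, x} \<in> edges G1 \<or> u = x \<and> {v, y} \<in> edges G2)}\<rparr>"

lemma simple_graph_lex_product:
  assumes "simple_graph G1" "simple_graph G2"
  shows "simple_graph (lex_product G1 G2)"
proof -
  have ne1: "u \<noteq> x" if "{u, x} \<in> edges G1" for u x
    using assms(1) that by (force simp: simple_graph_def)
  have ne2: "v \<noteq> y" if "{v, y} \<in> edges G2" for v y
    using assms(2) that by (force simp: simple_graph_def)
  show ?thesis
    using assms by (auto simp: simple_graph_def lex_product_def card_insert_if dest: ne1 ne2)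
qed

lemma ex_union_of_word_representable:
  assumes "simple_graph G"
  shows "\<exists>k>0. union_of_word_representable k G"
proof -
  let ?V = "(\<lambda>v. \<lparr>vertices = {v}, edges = {}\<rparr>) ` vertices G"
  let ?E = "(\<lambda>e. \<lparr>vertices = e, edges = {e}\<rparr>) ` edges G"
  let ?N = "\<lparr>vertices = {}, edges = {}\<rparr> :: 'a graph"
  have fin: "finite (vertices G)" and sub: "\<And>e. e \<in> edges G \<Longrightarrow> e \<subseteq> vertices G"
    and two: "\<And>e. e \<in> edges G \<Longrightarrow> card e = 2"
    using assms by (auto simp: simple_graph_def)
  have "finite (edges G)"
    by (rule finite_subset[of _ "Pow (vertices G)"]) (use fin sub in auto)
  with fin obtain Gs where Gs: "set Gs = insert ?N (?V \<union> ?E)"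
    using finite_list[of "insert ?N (?V \<union> ?E)"] by auto
  have "word_representable K" if K: "K \<in> set Gs" for K
  proof -
    consider "K = ?N" | v where "K = \<lparr>vertices = {v}, edges = {}\<rparr>"
      | e where "e \<in> edges G" "K = \<lparr>vertices = e, edges = {e}\<rparr>"
      using K unfolding Gs by blast
    then show ?thesis
    proof cases
      case 1
      then have "represents [] K" by (simp add: represents_def)
      then show ?thesis using 1 by (auto simp: word_representable_def simple_graph_def)
    next
      case (2 v)
      then have "represents [v] K" by (simp add: represents_def)
      then show ?thesis using 2 by (auto simp: word_representable_def simple_graph_def)
    next
      case (3 e)
      obtain a b where ab: "e = {a, b}" "a \<noteq> b" using two[OF 3(1)] by (auto simp: card_2_iff)
      have "represents [a, b] K"
        using 3(2) ab by (auto simp: represents_def alternate_def)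
      then show ?thesis using 3(2) ab by (auto simp: word_representable_def simple_graph_def)
    qed
  qed
  moreover have "graph_union Gs = G"
    by (auto simp: graph_union_def Gs intro!: graph.equality dest: subsetD[OF sub])
  moreover have "0 < length Gs" using Gs by (cases Gs) auto
  ultimately show ?thesis unfolding union_of_word_representable_def by blast
qed

end

theory Submission
  imports Defs
begin

text \<open>Delete a vertex \<open>a\<close> of \<open>G1\<close> and a vertex \<open>b\<close> of \<open>G2\<close>: by minimality, each \<open>Gi\<close> is the union
  of a word-representable graph and a star. The star at \<open>b\<close> is represented by a concatenation of two
  permutations, so it may be substituted for every vertex of a word-representable graph. Hence
  \<open>(G1 - a) \<circ> star b\<close> and \<open>star a \<circ> star b\<close> are word-representable; together they contain all edges
  between fibres and all edges at \<open>b\<close> within a fibre. The remaining edges form disjoint copies of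
  \<open>G2 - b\<close>.\<close>

section \<open>Words restricted to two letters\<close>

lemma alternate_commute: "alternate w x y \<longleftrightarrow> alternate w y x"
proof -
  have "(\<lambda>z. z = x \<or> z = y) = (\<lambda>z. z = y \<or> z = x)" by auto
  then show ?thesis by (simp add: alternate_def)
qed

lemma filter_eq_singleton:
  assumes "distinct p" "x \<in> set p"
  shows "filter (\<lambda>z. z = x) p = [x]"
  using assms by (induction p) (auto simp: filter_empty_conv)

lemma filter_distinct_pair:
  assumes "distinct p" "x \<in> set p" "y \<in> set p" "x \<noteq> y"
  shows "filter (\<lambda>z. z = x \<or> z = y) p = [x, y] \<or> filter (\<lambda>z. z = x \<or> z = y) p = [y, x]"
proof -
  let ?f = "filter (\<lambda>z. z = x \<or> z = y) p"
  have d: "distinct ?f" and s: "set ?f = {x, y}"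
    using assms by auto
  then have "length ?f = 2"
    using assms(4) distinct_card[OF d] by simp
  then obtain a b where "?f = [a, b]"
    by (auto simp: numeral_2_eq_2 length_Suc_conv)
  with d s show ?thesis by (auto simp: doubleton_eq_iff)
qed

lemma last_remdups: "last (remdups r) = last r"
  by (induction r) auto

text \<open>\<open>remdups r\<close> keeps last occurrences, so it ends in \<open>last r\<close>. It
  is duplicate-free with at least two letters, so its head differs from \<open>last r\<close> and
  the junction creates no equal neighbours; a single letter would be doubled there.\<close>

lemma distinct_adj_append_remdups:
  assumes "card (set r) \<ge> 2"
  shows "distinct_adj (r @ remdups r) \<longleftrightarrow> distinct_adj r"
proof -
  have "length (remdups r) \<ge> 2"
    using assms by (simp add: length_remdups_card_conv)
  then obtain a b s where s: "remdups r = a # b # s"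
    by (metis One_nat_def Suc_1 Suc_le_length_iff)
  have "distinct (a # b # s)"
    by (metis distinct_remdups s)
  then have "a \<noteq> last (a # b # s)" by auto
  then have "last r \<noteq> hd (remdups r)"
    by (metis last_remdups list.sel(1) s)
  moreover have "distinct_adj (remdups r)"
    by (simp add: distinct_adj_altdef remdups_adj_distinct)
  ultimately show ?thesis
    by (auto simp: distinct_adj_append_iff)
qed

lemma distinct_adj_concat_replicate_pair:
  assumes "c \<noteq> d"
  shows "distinct_adj (concat (replicate (Suc n) [c, d]) @ [e, f]) \<longleftrightarrow> d \<noteq> e \<and> e \<noteq> f"
  using assms by (induction n) auto

section \<open>Words for lexicographic products\<close>

text \<open>If \<open>p\<close> and \<open>q\<close> are permutations of the same letters, \<open>inflate p w @ inflate q (remdups w)\<close> will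
  represent a lexicographic product: appending \<open>remdups w\<close>, which lists the letters by their last
  occurrence, to \<open>w\<close> does not change which pairs alternate, and it guarantees that both \<open>p\<close> and \<open>q\<close> occur
  in every fibre.\<close>

definition inflate :: "'b list \<Rightarrow> 'a list \<Rightarrow> ('a \<times> 'b) list" where
  "inflate p w = concat (map (\<lambda>u. map (Pair u) p) w)"

lemma set_inflate: "set (inflate p w) = set w \<times> set p"
  by (auto simp: inflate_def)

lemma inflate_Nil [simp]: "inflate p [] = []"
  and inflate_Cons [simp]: "inflate p (u # w) = map (Pair u) p @ inflate p w"
  by (simp_all add: inflate_def)

text \<open>A permutation \<open>p\<close> contains \<open>v\<close> and \<open>y\<close> once each,
  so every block of \<open>u\<close> or \<open>x\<close> leaves exactly one letter.\<close>

lemma filter_inflate_distinct_fibres: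
  assumes "distinct p" "v \<in> set p" "y \<in> set p" "u \<noteq> x"
  shows "filter (\<lambda>z. z = (u, v) \<or> z = (x, y)) (inflate p w) =
    map (\<lambda>c. if c = u then (u, v) else (x, y)) (filter (\<lambda>c. c = u \<or> c = x) w)"
  using assms by (induction w) (auto simp: filter_map o_def filter_eq_singleton)

lemma filter_inflate_same_fibre:
  "filter (\<lambda>z. z = (u, v) \<or> z = (u, y)) (inflate p w) =
    concat (replicate (count_list w u) (map (Pair u) (filter (\<lambda>z. z = v \<or> z = y) p)))"
  by (induction w) (auto simp: filter_map o_def)

lemma count_list_remdups: "u \<in> set w \<Longrightarrow> count_list (remdups w) u = 1"
  by (induction w) auto

lemma alternate_inflate_distinct_fibres:
  assumes "distinct p" "distinct q" "set p = set q" "v \<in> set p" "y \<in> set p"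
    and "u \<in> set w" "x \<in> set w" "u \<noteq> x"
  shows "alternate (inflate p w @ inflate q (remdups w)) (u, v) (x, y) \<longleftrightarrow> alternate w u x"
proof -
  let ?r = "filter (\<lambda>c. c = u \<or> c = x) w"
  let ?h = "\<lambda>c. if c = u then (u, v) else (x, y)"
  have r: "set ?r = {u, x}" using assms by auto
  \<comment> \<open>\<open>?h\<close> is injective only on the two letters \<open>u\<close> and
    \<open>x\<close>, but no others survive in \<open>?r\<close>.\<close>
  have inj: "inj_on ?h (set (?r @ remdups ?r))" using assms(8) r by (auto simp: inj_on_def)
  have "filter (\<lambda>z. z = (u, v) \<or> z = (x, y)) (inflate p w @ inflate q (remdups w)) =
    map ?h (?r @ remdups ?r)"
    using assms by (simp add: filter_inflate_distinct_fibres remdups_filter)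
  then have "alternate (inflate p w @ inflate q (remdups w)) (u, v) (x, y) \<longleftrightarrow>
      distinct_adj (map ?h (?r @ remdups ?r))"
    unfolding alternate_def by simp
  also have "\<dots> \<longleftrightarrow> distinct_adj (?r @ remdups ?r)"
    using distinct_adj_map_iff[OF inj] .
  also have "\<dots> \<longleftrightarrow> distinct_adj ?r"
    using r assms(8) by (intro distinct_adj_append_remdups) simp
  finally show ?thesis by (simp add: alternate_def)
qed

text \<open>The restriction is \<open>c d\<close> repeated once per occurrence of \<open>u\<close>
  in \<open>w\<close>, then \<open>e f\<close> once. Repeating \<open>c d\<close> creates no equal
  neighbours, so only the junction with \<open>e f\<close> matters, just as in
  \<open>p @ q\<close>.\<close>

lemma alternate_inflate_same_fibre:
  assumes "distinct p" "distinct q" "set p = set q" "v \<in> set p" "y \<in> set p"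
    and "u \<in> set w" "v \<noteq> y"
  shows "alternate (inflate p w @ inflate q (remdups w)) (u, v) (u, y) \<longleftrightarrow> alternate (p @ q) v y"
proof -
  obtain n where n: "count_list w u = Suc n"
    using assms(6) by (metis count_list_0_iff not0_implies_Suc)
  obtain c d where cd: "filter (\<lambda>z. z = v \<or> z = y) p = [c, d]" "c \<noteq> d"
    using filter_distinct_pair[of p v y] assms by auto
  obtain e f where ef: "filter (\<lambda>z. z = v \<or> z = y) q = [e, f]" "e \<noteq> f"
    using filter_distinct_pair[of q v y] assms by auto
  show ?thesis
    using distinct_adj_concat_replicate_pair[of "(u, c)" "(u, d)" n "(u, e)" "(u, f)"]
    using cd ef assms(6)
    by (simp add: alternate_def filter_inflate_same_fibre n count_list_remdups)
qed

lemma edge_lex_product_iff: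
  "{(u, v), (x, y)} \<in> edges (lex_product G1 G2) \<longleftrightarrow>
    u \<in> vertices G1 \<and> v \<in> vertices G2 \<and> x \<in> vertices G1 \<and> y \<in> vertices G2 \<and>
    ({u, x} \<in> edges G1 \<or> u = x \<and> {v, y} \<in> edges G2)"
  by (auto simp: lex_product_def doubleton_eq_iff insert_commute)

lemma simple_graph_no_loop: "simple_graph G \<Longrightarrow> {x} \<notin> edges G"
  by (auto simp: simple_graph_def)

lemma word_representable_lex_product:
  assumes G: "word_representable G"
    and P: "simple_graph P" "represents (p @ q) P" "distinct p" "distinct q" "set p = set q"
  shows "word_representable (lex_product G P)"
proof -
  obtain w where w: "represents w G" and sG: "simple_graph G"
    using G by (auto simp: word_representable_def)
  have vG: "set w = vertices G" and vP: "set p = vertices P"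
    using w P by (auto simp: represents_def)
  have "represents (inflate p w @ inflate q (remdups w)) (lex_product G P)"
    unfolding represents_def
  proof (intro conjI ballI impI)
    show "set (inflate p w @ inflate q (remdups w)) = vertices (lex_product G P)"
      using vG vP P by (simp add: set_inflate lex_product_def)
  next
    fix s t assume "s \<in> vertices (lex_product G P)" "t \<in> vertices (lex_product G P)" "s \<noteq> t"
    then obtain u v x y where st: "s = (u, v)" "t = (x, y)"
      and mem: "u \<in> set w" "x \<in> set w" "v \<in> set p" "y \<in> set p" "u = x \<longrightarrow> v \<noteq> y"
      by (auto simp: lex_product_def vG vP)
    show "{s, t} \<in> edges (lex_product G P) \<longleftrightarrow>
        alternate (inflate p w @ inflate q (remdups w)) s t"
    proof (cases "u = x")
      case True
      \<comment> \<open>A loop of \<open>G\<close> at \<open>u\<close> would join all pairs in this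
        fibre, hence the appeal to simplicity.\<close>
      then show ?thesis
        using mem P alternate_inflate_same_fibre[of p q v y u w] simple_graph_no_loop[OF sG]
        by (auto simp: st edge_lex_product_iff represents_def vG vP)
    next
      case False
      then show ?thesis
        using mem P w alternate_inflate_distinct_fibres[of p q v y u w x]
        by (auto simp: st edge_lex_product_iff represents_def vG vP)
    qed
  qed
  then show ?thesis
    using simple_graph_lex_product[OF sG P(1)] by (auto simp: word_representable_def)
qed

section \<open>Stars as two permutations\<close>

text \<open>All vertices are kept, so that the product of two stars already has the vertex set of
  \<open>H\<close>.\<close>

definition star :: "'a graph \<Rightarrow> 'a \<Rightarrow> 'a graph" where
  "star G a = \<lparr>vertices = vertices G, edges = {e \<in> edges G. a \<in> e}\<rparr>"

lemma simple_graph_star: "simple_graph G \<Longrightarrow> simple_graph (star G a)"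
  by (simp add: simple_graph_def star_def)

lemma star_two_permutations:
  assumes "simple_graph G" "a \<in> vertices G"
  obtains p q where "represents (p @ q) (star G a)" "distinct p" "distinct q" "set p = set q"
proof -
  define N where "N = {x \<in> vertices G. {a, x} \<in> edges G}"
  have fin: "finite (vertices G)" using assms by (simp add: simple_graph_def)
  obtain L where L: "set L = N" "distinct L"
    using finite_distinct_list[of N] fin by (auto simp: N_def)
  obtain I where I: "set I = vertices G - insert a N" "distinct I"
    using finite_distinct_list[of "vertices G - insert a N"] fin by auto
  have aN: "a \<notin> N" using simple_graph_no_loop[OF assms(1)] by (simp add: N_def)
  \<comment> \<open>Everything except \<open>a\<close> is reversed from \<open>p\<close> to
    \<open>q\<close>, so pairs avoiding \<open>a\<close> read \<open>x y y x\<close>. A neighbour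
    \<open>y\<close> follows \<open>a\<close> both times, giving \<open>a y a y\<close>; a
    non-neighbour gives \<open>y a a y\<close>.\<close>
  define p where "p = I @ a # L"
  define q where "q = a # rev L @ rev I"
  have dist: "distinct p" "distinct q" and sets: "set p = vertices G" "set q = vertices G"
    using L I aN assms(2) by (auto simp: p_def q_def N_def)
  have edge: "{x, y} \<in> edges (star G a) \<longleftrightarrow> x = a \<and> y \<in> N \<or> y = a \<and> x \<in> N"
    if "x \<in> vertices G" "y \<in> vertices G" for x y
    using that by (auto simp: star_def N_def insert_commute)
  have nonalt: "\<not> alternate (p @ q) x y"
    if xy: "x \<in> vertices G" "y \<in> vertices G" "x \<noteq> y" "x \<noteq> a" "y \<noteq> a" for x y
  proof -
    have q: "filter (\<lambda>z. z = x \<or> z = y) q = rev (filter (\<lambda>z. z = x \<or> z = y) p)"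
      using xy by (simp add: p_def q_def rev_filter)
    show ?thesis
      using filter_distinct_pair[of p x y] dist sets xy by (auto simp: alternate_def q)
  qed
  have centre: "alternate (p @ q) a y \<longleftrightarrow> y \<in> N" if y: "y \<in> vertices G" "y \<noteq> a" for y
  proof -
    have *: "filter (\<lambda>z. z = a \<or> z = y) J = filter (\<lambda>z. z = y) J" if "a \<notin> set J" for J
      using that by (intro filter_cong) auto
    have **: "filter (\<lambda>z. z = y) J = []" if "y \<notin> set J" for J
      using that by (auto simp: filter_empty_conv)
    show ?thesis
    proof (cases "y \<in> N")
      case True
      then show ?thesis
        using y L I aN by (simp add: alternate_def p_def q_def * ** filter_eq_singleton)
    next
      case False
      then show ?thesis
        using y L I aN by (simp add: alternate_def p_def q_def * ** filter_eq_singleton)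
    qed
  qed
  have "represents (p @ q) (star G a)"
    unfolding represents_def
  proof (intro conjI ballI impI)
    show "set (p @ q) = vertices (star G a)" by (simp add: sets star_def)
  next
    fix x y assume "x \<in> vertices (star G a)" "y \<in> vertices (star G a)" "x \<noteq> y"
    then have xy: "x \<in> vertices G" "y \<in> vertices G" "x \<noteq> y" by (simp_all add: star_def)
    show "{x, y} \<in> edges (star G a) \<longleftrightarrow> alternate (p @ q) x y"
      using xy nonalt[of x y] centre[of x] centre[of y] alternate_commute[of "p @ q" x y] aN
      unfolding edge[OF xy(1,2)] by metis
  qed
  then show ?thesis using that dist sets by blast
qed

section \<open>Disjoint copies\<close>

text \<open>Provides a representing word in which every vertex occurs at least twice.\<close>

lemma represents_append_remdups:
  assumes "represents w G"
  shows "represents (w @ remdups w) G"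
proof -
  have "alternate (w @ remdups w) x y \<longleftrightarrow> alternate w x y"
    if "x \<in> set w" "y \<in> set w" "x \<noteq> y" for x y
  proof -
    have "set (filter (\<lambda>z. z = x \<or> z = y) w) = {x, y}" using that by auto
    then have "card (set (filter (\<lambda>z. z = x \<or> z = y) w)) \<ge> 2" using that(3) by simp
    from distinct_adj_append_remdups[OF this] show ?thesis
      by (simp add: alternate_def remdups_filter)
  qed
  then show ?thesis using assms by (auto simp: represents_def)
qed

text \<open>A block of \<open>u\<close> contains \<open>(u, v)\<close> at least twice and no letter
  of the fibre of \<open>x\<close>. The last \<open>v\<close> of \<open>w\<close> and the
  \<open>v\<close> of \<open>remdups w\<close> become equal neighbours.\<close>

lemma not_alternate_inflate_append_remdups:
  assumes "u \<in> set us" "v \<in> set w" "u \<noteq> x"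
  shows "\<not> alternate (inflate (w @ remdups w) us) (u, v) (x, y)"
proof -
  obtain A B where us: "us = A @ u # B"
    using assms(1) by (meson split_list)
  let ?F = "filter (\<lambda>z. z = (u, v) \<or> z = (x, y))"
  let ?f = "filter (\<lambda>z. z = v) w"
  have ne: "?f \<noteq> []" using assms(2) by (auto simp: filter_empty_conv)
  have "last ?f \<in> set ?f" using ne by (rule last_in_set)
  then have last: "last ?f = v" by simp
  have rem: "filter (\<lambda>z. z = v) (remdups w) = [v]"
    using assms(2) by (intro filter_eq_singleton) auto
  have "?F (map (Pair u) (w @ remdups w)) = map (Pair u) (?f @ [v])"
    using assms(3) rem by (simp add: filter_map o_def)
  then have "?F (inflate (w @ remdups w) us) =
      ?F (inflate (w @ remdups w) A) @ map (Pair u) (?f @ [v]) @ ?F (inflate (w @ remdups w) B)"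
    by (simp add: us inflate_def)
  then show ?thesis
    using ne last by (auto simp: alternate_def distinct_adj_append_iff last_map)
qed

text \<open>The copies of the word are written one after another, one per vertex of
  \<open>V\<close>. Inside a fibre the word is unchanged; across fibres the repeated letters prevent
  alternation.\<close>

lemma word_representable_edgeless_lex_product:
  assumes "finite V" "word_representable G"
  shows "word_representable (lex_product \<lparr>vertices = V, edges = {}\<rparr> G)"
proof -
  obtain w where w: "represents w G" and sG: "simple_graph G"
    using assms by (auto simp: word_representable_def)
  obtain us where us: "set us = V" "distinct us"
    using finite_distinct_list[OF assms(1)] by auto
  have vG: "set w = vertices G"
    using w by (simp add: represents_def)
  let ?E = "\<lparr>vertices = V, edges = {}\<rparr>"
  let ?w = "w @ remdups w"
  have w2: "represents ?w G" by (rule represents_append_remdups[OF w])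
  have "represents (inflate ?w us) (lex_product ?E G)"
    unfolding represents_def
  proof (intro conjI ballI impI)
    show "set (inflate ?w us) = vertices (lex_product ?E G)"
      by (simp add: set_inflate lex_product_def us vG)
  next
    fix s t assume "s \<in> vertices (lex_product ?E G)" "t \<in> vertices (lex_product ?E G)" "s \<noteq> t"
    then obtain u v x y where st: "s = (u, v)" "t = (x, y)"
      and mem: "u \<in> V" "x \<in> V" "v \<in> vertices G" "y \<in> vertices G" "u = x \<longrightarrow> v \<noteq> y"
      by (auto simp: lex_product_def)
    show "{s, t} \<in> edges (lex_product ?E G) \<longleftrightarrow> alternate (inflate ?w us) s t"
    proof (cases "u = x")
      case True
      have "count_list us x = 1"
        using count_list_remdups[of x us] us mem by (simp add: distinct_remdups_id)
      then have "filter (\<lambda>z. z = (x, v) \<or> z = (x, y)) (inflate ?w us) =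
          map (Pair x) (filter (\<lambda>z. z = v \<or> z = y) ?w)"
        unfolding filter_inflate_same_fibre by simp
      then have "alternate (inflate ?w us) s t \<longleftrightarrow> alternate ?w v y"
        unfolding alternate_def st True by (simp add: distinct_adj_map_iff inj_on_def del: filter_append)
      then show ?thesis
        using True mem w2 by (auto simp: st edge_lex_product_iff represents_def)
    next
      case False
      then show ?thesis
        using mem us not_alternate_inflate_append_remdups[of u us v w x y]
        by (simp add: st edge_lex_product_iff vG)
    qed
  qed
  moreover have "simple_graph ?E" using assms(1) by (simp add: simple_graph_def)
  ultimately show ?thesis
    using simple_graph_lex_product[OF _ sG] by (auto simp: word_representable_def)
qed

section \<open>Covering the product by three graphs\<close>

lemma minimal_non_word_representable_nonempty:
  assumes "minimal_non_word_representable G"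
  shows "vertices G \<noteq> {}"
proof
  assume "vertices G = {}"
  then have "represents [] G" by (simp add: represents_def)
  then show False
    using assms by (auto simp: minimal_non_word_representable_def word_representable_def)
qed

theorem theorem12:
  fixes G1 :: "'a graph" and G2 :: "'b graph" and H :: "('a \<times> 'b) graph"
  assumes "minimal_non_word_representable G1"
    and "minimal_non_word_representable G2"
    and "H = lex_product G1 G2"
  shows "multi_word_representation_number H \<le> 3"
proof -
  obtain a b where ab: "a \<in> vertices G1" "b \<in> vertices G2"
    using assms minimal_non_word_representable_nonempty by (metis all_not_in_conv)
  let ?D1 = "induced_subgraph G1 (vertices G1 - {a})"
  let ?D2 = "induced_subgraph G2 (vertices G2 - {b})"
  let ?E = "\<lparr>vertices = vertices G1, edges = {}\<rparr>"
  have simple: "simple_graph G1" "simple_graph G2"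
    and wr: "word_representable ?D1" "word_representable ?D2"
    using assms ab unfolding minimal_non_word_representable_def by blast+
  have fin: "finite (vertices G1)" using simple by (simp add: simple_graph_def)
  obtain p q where pq: "represents (p @ q) (star G2 b)" "distinct p" "distinct q" "set p = set q"
    using star_two_permutations[OF simple(2) ab(2)] .
  have star1: "word_representable (star G1 a)"
    using star_two_permutations[OF simple(1) ab(1)] simple_graph_star[OF simple(1)]
    by (metis word_representable_def)
  \<comment> \<open>Edges between fibres lie in \<open>?K1\<close> if their projection to
    \<open>G1\<close> avoids \<open>a\<close>, and in \<open>?K2\<close> otherwise. Within each
    fibre, \<open>?K2\<close> contains the edges at \<open>b\<close> and \<open>?K3\<close> those
    avoiding \<open>b\<close>. Overlaps are harmless in a union.\<close>
  let ?K1 = "lex_product ?D1 (star G2 b)"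
  let ?K2 = "lex_product (star G1 a) (star G2 b)"
  let ?K3 = "lex_product ?E ?D2"
  have K: "word_representable ?K1" "word_representable ?K2" "word_representable ?K3"
    using word_representable_lex_product[OF _ simple_graph_star[OF simple(2)] pq] wr star1
      word_representable_edgeless_lex_product[OF fin wr(2)] by blast+
  have edge_iff: "{(u, v), (x, y)} \<in> edges H \<longleftrightarrow>
      {(u, v), (x, y)} \<in> edges ?K1 \<union> edges ?K2 \<union> edges ?K3" for u v x y
    using simple ab unfolding assms(3)
    by (auto simp: edge_lex_product_iff star_def induced_subgraph_def simple_graph_def)
  \<comment> \<open>All edges are sets of two explicit pairs, which lifts \<open>edge_iff\<close> to
    equality of the edge sets.\<close>
  have pair: "\<exists>u v x y. e = {(u, v), (x, y)}"
    if "e \<in> edges H \<union> edges ?K1 \<union> edges ?K2 \<union> edges ?K3" for e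
    using that unfolding assms(3) lex_product_def by auto
  have "edges H = edges ?K1 \<union> edges ?K2 \<union> edges ?K3"
  proof (rule set_eqI)
    fix e
    show "e \<in> edges H \<longleftrightarrow> e \<in> edges ?K1 \<union> edges ?K2 \<union> edges ?K3"
      using pair[of e] edge_iff by blast
  qed
  moreover have "vertices H = vertices ?K1 \<union> vertices ?K2 \<union> vertices ?K3"
    by (auto simp: assms(3) lex_product_def star_def induced_subgraph_def)
  ultimately have "graph_union [?K1, ?K2, ?K3] = H"
    by (simp add: graph_union_def Un_assoc)
  then have "union_of_word_representable 3 H"
    using K unfolding union_of_word_representable_def
    by (intro exI[of _ "[?K1, ?K2, ?K3]"]) simp
  then show ?thesis
    unfolding multi_word_representation_number_def by (intro Least_le) simp
qed

end
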